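(* For every $v\equiv 0,6,12 \pmod{24}$ with $v\ge 12$, there exists a $2$-split decomposition of $K_v^{(3)}-I$ into tight $6$-cycles.
   Context: $K_v^{(3)}$ denotes the complete $3$-uniform hypergraph on $v$ vertices; for $3\mid v$, $K_v^{(3)}-I$ is obtained by deleting the edges of a $1$-factor $I$ (a set of $v/3$ pairwise disjoint triples covering all vertices). A (3-uniform tight) $k$-cycle is given by a cyclic sequence $v_1,\dots,v_k$ of $k$ distinct vertices, its edges being the triples $\{v_i,v_{i+1},v_{i+2}\}$ ($i=1,\dots,k$, indices mod $k$). A decomposition is a collection of cycles whose edge sets partition the edge set. For even $v$ with $3\mid v/2$, a $2$-split decomposition of $K_v^{(3)}-I$ into $k$-cycles is one where the vertex set is partitioned into two sets $V_1,V_2$ of size $v/2$, the $1$-factor is $I=I_1\cup I_2$ with $I_j$ a $1$-factor of $V_j$, and the collection of cycles consists of a $k$-cycle decomposition of $K^{(3)}[V_1]-I_1$, a $k$-cycle decomposition of $K^{(3)}[V_2]-I_2$, and a $k$-cycle decomposition of the hypergraph of all triples meeting both $V_1$ and $V_2$. *)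

theory Defs
  imports Main
begin

definition triples :: "'a set \<Rightarrow> 'a set set" where
  "triples V = {e. e \<subseteq> V \<and> card e = 3}"

definition one_factor :: "'a set \<Rightarrow> 'a set set \<Rightarrow> bool" where
  "one_factor V I \<longleftrightarrow> I \<subseteq> triples V \<and> \<Union>I = V \<and>
     (\<forall>e\<in>I. \<forall>f\<in>I. e \<noteq> f \<longrightarrow> e \<inter> f = {})"

definition tight_cycle :: "nat \<Rightarrow> 'a list \<Rightarrow> bool" where
  "tight_cycle k xs \<longleftrightarrow> length xs = k \<and> distinct xs"

definition cycle_edges :: "'a list \<Rightarrow> 'a set set" where
  "cycle_edges xs = (let k = length xs in
     {{xs ! i, xs ! ((i + 1) mod k), xs ! ((i + 2) mod k)} | i. i < k})"

definition cycle_decomposition :: "nat \<Rightarrow> 'a set set \<Rightarrow> 'a list set \<Rightarrow> bool" where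
  "cycle_decomposition k H C \<longleftrightarrow>
     (\<forall>c\<in>C. tight_cycle k c \<and> cycle_edges c \<subseteq> H) \<and>
     (\<forall>e\<in>H. \<exists>!c. c \<in> C \<and> e \<in> cycle_edges c)"

definition mixed_triples :: "'a set \<Rightarrow> 'a set \<Rightarrow> 'a set set" where
  "mixed_triples V1 V2 = {e \<in> triples (V1 \<union> V2). e \<inter> V1 \<noteq> {} \<and> e \<inter> V2 \<noteq> {}}"

definition two_split_decomposition :: "nat \<Rightarrow> 'a set \<Rightarrow> 'a set set \<Rightarrow> bool" where
  "two_split_decomposition k V I \<longleftrightarrow>
     (\<exists>V1 V2 I1 I2 C1 C2 C3.
        V1 \<union> V2 = V \<and> V1 \<inter> V2 = {} \<and>
        card V1 = card V div 2 \<and> card V2 = card V div 2 \<and>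
        one_factor V1 I1 \<and> one_factor V2 I2 \<and> I = I1 \<union> I2 \<and>
        cycle_decomposition k (triples V1 - I1) C1 \<and>
        cycle_decomposition k (triples V2 - I2) C2 \<and>
        cycle_decomposition k (mixed_triples V1 V2) C3)"

end

theory Submission
  imports Defs
begin

text \<open>
  Cut the two halves into groups of three consecutive vertices and let the groups be the 1-factor.
  Every other triple meets either two or three groups. The triples meeting exactly two given groups
  form a copy of \<open>K\<^sub>6 - I\<close>, which splits into three 6-cycles. The 27 transversals of three groups
  are an odd number, but two triples of groups with two groups in common give together a complete
  tripartite hypergraph \<open>K\<^sub>3\<^sub>,\<^sub>3\<^sub>,\<^sub>6\<close>, which splits into nine 6-cycles. With \<open>m\<close> groups in each
  half it remains to match up the triples of groups within a half, and the mixed ones, such that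
  matched triples share two groups; this is possible for \<open>m mod 4 \<noteq> 3\<close>.
\<close>

text \<open>Only existence of the cycles is propagated; the collections themselves reappear in the
  theorem.\<close>

definition decomposable :: "'a set set \<Rightarrow> bool" where
  "decomposable H \<longleftrightarrow> (\<exists>C. cycle_decomposition 6 H C)"

text \<open>Group \<open>i\<close> is \<open>{3 * i, 3 * i + 1, 3 * i + 2}\<close>.\<close>

definition blowup :: "nat set set \<Rightarrow> nat set set" where
  "blowup F = {e. card e = 3 \<and> (\<lambda>x. x div 3) ` e \<in> F}"

section \<open>Disjoint unions, injective images and relabelling of groups\<close>

lemma decomposable_UN:
  assumes dec: "\<And>i. i \<in> I \<Longrightarrow> decomposable (H i)"
    and disj: "\<And>i j. \<lbrakk>i \<in> I; j \<in> I; i \<noteq> j\<rbrakk> \<Longrightarrow> H i \<inter> H j = {}"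
  shows "decomposable (\<Union>i\<in>I. H i)"
proof -
  obtain C where C: "\<And>i. i \<in> I \<Longrightarrow> cycle_decomposition 6 (H i) (C i)"
    using dec unfolding decomposable_def by metis
  have sub: "cycle_edges c \<subseteq> H i" if "i \<in> I" "c \<in> C i" for i c
    using C[OF that(1)] that(2) by (simp add: cycle_decomposition_def)
  have "cycle_decomposition 6 (\<Union>i\<in>I. H i) (\<Union>i\<in>I. C i)"
    unfolding cycle_decomposition_def
  proof (intro conjI ballI)
    fix c assume "c \<in> (\<Union>i\<in>I. C i)"
    then obtain i where i: "i \<in> I" "c \<in> C i" by blast
    then show "tight_cycle 6 c" using C by (auto simp: cycle_decomposition_def)
    show "cycle_edges c \<subseteq> (\<Union>i\<in>I. H i)" using sub[OF i] i(1) by blast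
  next
    fix e assume "e \<in> (\<Union>i\<in>I. H i)"
    then obtain i where i: "i \<in> I" "e \<in> H i" by blast
    then have "\<exists>!c. c \<in> C i \<and> e \<in> cycle_edges c"
      using C by (simp add: cycle_decomposition_def)
    \<comment> \<open>A cycle through \<open>e\<close> taken from another \<open>C j\<close> would
      put \<open>e\<close> into both \<open>H i\<close> and \<open>H j\<close>.\<close>
    moreover have "c \<in> C i" if "c \<in> (\<Union>i\<in>I. C i)" "e \<in> cycle_edges c" for c
      using that sub i disj by blast
    ultimately show "\<exists>!c. c \<in> (\<Union>i\<in>I. C i) \<and> e \<in> cycle_edges c"
      using i by (metis UN_I)
  qed
  then show ?thesis unfolding decomposable_def by blast
qed

text \<open>Listing the edges by position makes them executable, so that \<open>code_simp\<close>
  can check concrete cycles.\<close>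

lemma cycle_edges_code [code]:
  "cycle_edges xs = (let k = length xs in
     set (map (\<lambda>i. {xs ! i, xs ! ((i + 1) mod k), xs ! ((i + 2) mod k)}) [0..<k]))"
  by (auto simp: cycle_edges_def Let_def)

lemma cycle_edges_map: "cycle_edges (map f c) = image f ` cycle_edges c"
  by (cases "c = []") (auto simp: cycle_edges_code Let_def image_image intro!: image_cong)

text \<open>Injectivity on the covered vertices suffices: every vertex of a cycle lies on one of its
  edges, so mapped cycles stay distinct, and different edges of \<open>H\<close> have different
  images, so each image edge keeps its unique cycle.\<close>

lemma decomposable_image:
  assumes "decomposable H" and inj: "inj_on f (\<Union>H)"
  shows "decomposable (image f ` H)"
proof -
  obtain C where C: "cycle_decomposition 6 H C"
    using assms(1) unfolding decomposable_def by blast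
  have injH: "inj_on (image f) H"
    using inj by (auto intro!: inj_onI dest: inj_on_image_eq_iff[OF inj, THEN iffD1, rotated 2])
  have tight: "tight_cycle 6 c" and sub: "cycle_edges c \<subseteq> H" if "c \<in> C" for c
    using C that by (auto simp: cycle_decomposition_def)
  have set_c: "set c \<subseteq> \<Union>H" if "c \<in> C" for c
  proof
    fix x assume "x \<in> set c"
    then obtain i where "i < length c" "x = c ! i" by (auto simp: in_set_conv_nth)
    then have "\<exists>e\<in>cycle_edges c. x \<in> e" by (auto simp: cycle_edges_def Let_def)
    then show "x \<in> \<Union>H" using sub[OF that] by blast
  qed
  have mem: "f ` e \<in> cycle_edges (map f c) \<longleftrightarrow> e \<in> cycle_edges c" if "c \<in> C" "e \<in> H" for c e
    using inj_on_image_mem_iff[OF injH that(2) sub[OF that(1)]] by (simp add: cycle_edges_map)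
  have "cycle_decomposition 6 (image f ` H) (map f ` C)"
    unfolding cycle_decomposition_def
  proof (intro conjI ballI)
    fix c assume "c \<in> map f ` C"
    then obtain d where d: "d \<in> C" "c = map f d" by blast
    show "tight_cycle 6 c"
      using tight[OF d(1)] inj_on_subset[OF inj set_c[OF d(1)]] d(2)
      by (simp add: tight_cycle_def distinct_map)
    show "cycle_edges c \<subseteq> image f ` H"
      using sub[OF d(1)] d(2) by (auto simp: cycle_edges_map)
  next
    fix e assume "e \<in> image f ` H"
    then obtain h where h: "h \<in> H" "e = f ` h" by blast
    then have "\<exists>!c. c \<in> C \<and> h \<in> cycle_edges c"
      using C by (simp add: cycle_decomposition_def)
    then obtain c where c: "c \<in> C" "h \<in> cycle_edges c"
      and uniq: "\<And>d. d \<in> C \<Longrightarrow> h \<in> cycle_edges d \<Longrightarrow> d = c" by blast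
    show "\<exists>!c. c \<in> map f ` C \<and> e \<in> cycle_edges c"
    proof (rule ex1I[of _ "map f c"])
      show "map f c \<in> map f ` C \<and> e \<in> cycle_edges (map f c)"
        using c mem h by blast
    next
      fix d assume "d \<in> map f ` C \<and> e \<in> cycle_edges d"
      then show "d = map f c" using mem h uniq by blast
    qed
  qed
  then show ?thesis unfolding decomposable_def by blast
qed

text \<open>A relabelling \<open>h\<close> of groups lifts to the point map \<open>f\<close> that
  moves group \<open>i\<close> to group \<open>h i\<close> and keeps residues mod 3. It is injective
  on the points of the groups in \<open>\<Union>F\<close>, so the decomposition is carried over by
  \<open>f\<close>.\<close>

lemma decomposable_blowup_image:
  fixes h :: "nat \<Rightarrow> nat"
  assumes dec: "decomposable (blowup F)" and inj: "inj_on h (\<Union>F)"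
  shows "decomposable (blowup (image h ` F))"
proof -
  define g :: "nat \<Rightarrow> nat" where "g = (\<lambda>x. x div 3)"
  define f where "f x = 3 * h (g x) + x mod 3" for x
  have bl: "e \<in> blowup X \<longleftrightarrow> card e = 3 \<and> g ` e \<in> X" for e X
    by (simp add: blowup_def g_def)
  have gf: "g (f x) = h (g x)" for x
    by (simp add: f_def g_def)
  have inj_f: "inj_on f {x. g x \<in> \<Union>F}"
  proof (rule inj_onI)
    fix x y assume xy: "x \<in> {x. g x \<in> \<Union>F}" "y \<in> {x. g x \<in> \<Union>F}" "f x = f y"
    then have "h (g x) = h (g y)" by (metis gf)
    then have "g x = g y" using inj_onD[OF inj] xy by blast
    then show "x = y" using xy(3) unfolding f_def g_def
      by (metis add_left_cancel div_mult_mod_eq)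
  qed
  have sub: "e \<subseteq> {x. g x \<in> \<Union>F}" if "e \<in> blowup F" for e
    using that unfolding bl by blast
  have "blowup (image h ` F) = image f ` blowup F"
  proof (intro equalityI subsetI)
    fix e assume "e \<in> blowup (image h ` F)"
    then obtain S where S: "S \<in> F" "card e = 3" "g ` e = h ` S"
      by (auto simp: bl)
    \<comment> \<open>Candidate preimage of \<open>e\<close>: the points in groups of
      \<open>S\<close> that \<open>f\<close> sends into \<open>e\<close>.\<close>
    define e' where "e' = {y. g y \<in> S \<and> f y \<in> e}"
    have "e \<subseteq> f ` e'"
    proof
      fix x assume x: "x \<in> e"
      then obtain s where s: "s \<in> S" "g x = h s" using S(3) by blast
      \<comment> \<open>The point of group \<open>s\<close> with the same residue as
        \<open>x\<close> is the preimage of \<open>x\<close>.\<close>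
      have "g (3 * s + x mod 3) = s" by (simp add: g_def)
      moreover have "f (3 * s + x mod 3) = 3 * g x + x mod 3"
        using s(2) by (simp add: f_def g_def)
      moreover have "3 * g x + x mod 3 = x" by (simp add: g_def)
      ultimately show "x \<in> f ` e'" using x s(1) unfolding e'_def
        by (metis (mono_tags, lifting) imageI mem_Collect_eq)
    qed
    then have e: "e = f ` e'" by (auto simp: e'_def)
    have "inj_on f e'"
      by (rule inj_on_subset[OF inj_f]) (use S(1) in \<open>auto simp: e'_def\<close>)
    then have "card e' = 3" using S(2) e by (simp add: card_image)
    moreover have "g ` e' = S"
    proof -
      have "h ` g ` e' = h ` S" using S(3) e by (simp add: image_image gf)
      moreover have "inj_on h S" using inj by (rule inj_on_subset) (use S(1) in auto)
      moreover have "g ` e' \<subseteq> S" by (auto simp: e'_def)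
      ultimately show ?thesis by (meson inj_on_image_eq_iff subset_refl)
    qed
    ultimately show "e \<in> image f ` blowup F"
      using e S(1) by (auto simp: bl)
  next
    fix e assume "e \<in> image f ` blowup F"
    then obtain d where d: "d \<in> blowup F" "e = f ` d" by blast
    then have "card e = 3"
      using card_image[OF inj_on_subset[OF inj_f sub]] by (simp add: bl)
    moreover have "g ` e = h ` g ` d" by (simp add: d(2) image_image gf)
    ultimately show "e \<in> blowup (image h ` F)" using d(1) by (auto simp: bl)
  qed
  moreover have "inj_on f (\<Union>(blowup F))"
    by (rule inj_on_subset[OF inj_f]) (use sub in blast)
  ultimately show ?thesis using decomposable_image[OF dec] by simp
qed

section \<open>Two explicit decompositions, verified by evaluation\<close>

lemma decomposable_blowup_list:
  assumes tight: "\<forall>c\<in>set cs. length c = 6 \<and> distinct c"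
    and disj: "sorted_wrt (\<lambda>c d. cycle_edges c \<inter> cycle_edges d = {}) cs"
    and sub: "\<forall>c\<in>set cs. \<forall>e\<in>cycle_edges c. card e = 3 \<and> (\<lambda>x. x div 3) ` e \<in> F"
    and cover: "\<And>e. e \<in> blowup F \<Longrightarrow> \<exists>c\<in>set cs. e \<in> cycle_edges c"
  shows "decomposable (blowup F)"
  unfolding decomposable_def cycle_decomposition_def
proof (intro exI[of _ "set cs"] conjI ballI)
  fix e assume "e \<in> blowup F"
  \<comment> \<open>Cycles at different positions of the list have no common edge, so both sit at
    the same position.\<close>
  moreover have "c = d" if "c \<in> set cs" "d \<in> set cs" "e \<in> cycle_edges c" "e \<in> cycle_edges d" for c d
    using that sorted_wrt_nth_less[OF disj] unfolding in_set_conv_nth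
    by (metis (no_types, lifting) Int_iff empty_iff linorder_neqE_nat)
  ultimately show "\<exists>!c. c \<in> set cs \<and> e \<in> cycle_edges c"
    using cover by blast
qed (use tight sub in \<open>auto simp: tight_cycle_def blowup_def\<close>)

lemma div_3_eq_cases:
  fixes x :: nat
  shows "x div 3 = 0 \<Longrightarrow> x \<in> {0, 1, 2}" "x div 3 = 1 \<Longrightarrow> x \<in> {3, 4, 5}"
    "x div 3 = 2 \<Longrightarrow> x \<in> {6, 7, 8}" "x div 3 = 3 \<Longrightarrow> x \<in> {9, 10, 11}"
  by auto

text \<open>This is \<open>K_6 - I\<close> on the points 0 to 5: 18 triples in three cycles.\<close>

lemma decomposable_blowup_01: "decomposable (blowup {{0, 1}})"
proof (rule decomposable_blowup_list)
  let ?cs = "[[0, 1, 5, 2, 3, 4], [0, 2, 5, 4, 1, 3], [0, 4, 2, 1, 3, 5]] :: nat list list"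
  show "\<forall>c\<in>set ?cs. length c = 6 \<and> distinct c" by code_simp
  show "sorted_wrt (\<lambda>c d. cycle_edges c \<inter> cycle_edges d = {}) ?cs" by code_simp
  show "\<forall>c\<in>set ?cs. \<forall>e\<in>cycle_edges c. card e = 3 \<and> (\<lambda>x. x div 3) ` e \<in> {{0, 1}}"
    by code_simp
  \<comment> \<open>An edge has a point in each group and one further point in either, which turns
    coverage into a finite check.\<close>
  have cover: "\<forall>x\<in>{0,1,2}. \<forall>y\<in>{3,4,5}. \<forall>z\<in>{0,1,2,3,4,5}.
        z \<noteq> x \<and> z \<noteq> y \<longrightarrow> (\<exists>c\<in>set ?cs. {x, y, z} \<in> cycle_edges c)" by code_simp
  fix e :: "nat set" assume "e \<in> blowup {{0, 1}}"
  then have e: "card e = 3" "(\<lambda>x. x div 3) ` e = {0, 1}"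
    by (auto simp: blowup_def)
  obtain x y where x: "x \<in> e" "x div 3 = 0" and y: "y \<in> e" "y div 3 = 1"
    using e(2) by (metis (no_types, lifting) imageE insertI1 insertI2)
  then have "x \<noteq> y" by auto
  then have "card (e - {x, y}) = 1"
    using x y e(1) by (simp add: card_Diff_subset)
  then obtain z where "e - {x, y} = {z}" by (auto simp: card_1_singleton_iff)
  then have z: "e = {x, y, z}" "z \<noteq> x \<and> z \<noteq> y" using x y by auto
  then have "z div 3 \<in> {0, 1}" using e(2) by blast
  then have "z \<in> {0, 1, 2, 3, 4, 5}" using div_3_eq_cases[of z] by auto
  from cover[rule_format, OF div_3_eq_cases(1)[OF x(2)] div_3_eq_cases(2)[OF y(2)] this z(2)]
  show "\<exists>c\<in>set ?cs. e \<in> cycle_edges c" unfolding z(1) .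
qed

text \<open>This is \<open>K_{3,3,6}\<close> with the six points 6 to 11 as third class: 54 triples
  in nine cycles.\<close>

lemma decomposable_blowup_012_013: "decomposable (blowup {{0, 1, 2}, {0, 1, 3}})"
proof (rule decomposable_blowup_list)
  \<comment> \<open>The second row is the first with 6 replaced by 9 and with 7 and 8 exchanged;
    together they cover the triples through 6, 7, 8 and 9. The third row covers those through 10 and
    11.\<close>
  let ?cs = "[[0, 3, 6, 1, 5, 8], [1, 7, 3, 2, 6, 4], [0, 4, 7, 2, 5, 6],
    [0, 3, 9, 1, 5, 7], [1, 8, 3, 2, 9, 4], [0, 4, 8, 2, 5, 9],
    [0, 10, 3, 1, 11, 4], [1, 10, 4, 2, 11, 5], [0, 11, 3, 2, 10, 5]] :: nat list list"
  show "\<forall>c\<in>set ?cs. length c = 6 \<and> distinct c" by code_simp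
  show "sorted_wrt (\<lambda>c d. cycle_edges c \<inter> cycle_edges d = {}) ?cs" by code_simp
  show "\<forall>c\<in>set ?cs. \<forall>e\<in>cycle_edges c.
      card e = 3 \<and> (\<lambda>x. x div 3) ` e \<in> {{0, 1, 2}, {0, 1, 3}}"
    by code_simp
  have cover: "\<forall>x\<in>{0,1,2}. \<forall>y\<in>{3,4,5}. \<forall>z\<in>{6,7,8,9,10,11}.
      \<exists>c\<in>set ?cs. {x, y, z} \<in> cycle_edges c" by code_simp
  fix e :: "nat set" assume "e \<in> blowup {{0, 1, 2}, {0, 1, 3}}"
  then obtain k where e: "card e = 3" "(\<lambda>x. x div 3) ` e = {0, 1, k}" and k: "k = 2 \<or> k = 3"
    unfolding blowup_def by blast
  obtain x y z where x: "x \<in> e" "x div 3 = 0" and y: "y \<in> e" "y div 3 = 1"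
    and z: "z \<in> e" "z div 3 = k"
    using e(2) by (metis (no_types, lifting) imageE insertI1 insertI2)
  then have "card {x, y, z} = 3" using k by (auto simp: card_insert_if)
  moreover have "finite e" using e(1) by (simp add: card_ge_0_finite)
  ultimately have xyz: "e = {x, y, z}"
    using x y z e(1) by (metis card_subset_eq empty_subsetI insert_subset)
  have "z \<in> {6, 7, 8, 9, 10, 11}" using div_3_eq_cases[of z] k z(2) by auto
  from cover[rule_format, OF div_3_eq_cases(1)[OF x(2)] div_3_eq_cases(2)[OF y(2)] this]
  show "\<exists>c\<in>set ?cs. e \<in> cycle_edges c" unfolding xyz .
qed

section \<open>Gluing blow-ups, and matching triples that share a fixed pair of groups\<close>

lemma decomposable_blowup_UN:
  assumes "\<And>i. i \<in> I \<Longrightarrow> decomposable (blowup (F i))"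
    and "\<And>i j. \<lbrakk>i \<in> I; j \<in> I; i \<noteq> j\<rbrakk> \<Longrightarrow> F i \<inter> F j = {}"
  shows "decomposable (blowup (\<Union>i\<in>I. F i))"
proof -
  have "decomposable (\<Union>i\<in>I. blowup (F i))"
    by (rule decomposable_UN) (use assms in \<open>force simp: blowup_def\<close>)+
  moreover have "(\<Union>i\<in>I. blowup (F i)) = blowup (\<Union>i\<in>I. F i)"
    by (auto simp: blowup_def)
  ultimately show ?thesis by simp
qed

lemma decomposable_blowup_Un:
  assumes "decomposable (blowup F)" "decomposable (blowup G)" "F \<inter> G = {}"
  shows "decomposable (blowup (F \<union> G))"
proof -
  \<comment> \<open>The binary union is read as a family indexed by the truth values.\<close>
  have "decomposable (blowup (\<Union>b\<in>UNIV. if b then F else G))"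
    by (rule decomposable_blowup_UN) (use assms in auto)
  then show ?thesis by (simp add: UNIV_bool Un_commute)
qed

lemma decomposable_blowup_empty: "decomposable (blowup {})"
  by (auto simp: blowup_def decomposable_def cycle_decomposition_def)

definition pairs :: "'a set \<Rightarrow> 'a set set" where
  "pairs M = {p. p \<subseteq> M \<and> card p = 2}"

text \<open>For a pair \<open>p\<close> disjoint from \<open>W\<close>, any two of these triples
  share \<open>p\<close> and may be matched. With a singleton \<open>p\<close> it gives the pairs
  through one element.\<close>

definition star :: "'a set \<Rightarrow> 'a set \<Rightarrow> 'a set set" where
  "star p W = (\<lambda>w. insert w p) ` W"

lemma decomposable_blowup_pair:
  fixes a b :: nat
  assumes "a \<noteq> b"
  shows "decomposable (blowup {{a, b}})"
proof -
  define h where "h i = (if i = 0 then a else b)" for i :: nat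
  have "inj_on h (\<Union>{{0, 1}})" using assms by (auto simp: inj_on_def h_def)
  from decomposable_blowup_image[OF decomposable_blowup_01 this]
  show ?thesis by (simp add: h_def insert_commute)
qed

text \<open>Each pair of groups carries its own copy of \<open>K_6 - I\<close>, so no parity
  condition arises here.\<close>

lemma decomposable_blowup_pairs:
  assumes "\<And>p. p \<in> F \<Longrightarrow> card p = 2"
  shows "decomposable (blowup F)"
proof -
  have "decomposable (blowup (\<Union>p\<in>F. {p}))"
  proof (rule decomposable_blowup_UN)
    fix p assume "p \<in> F"
    then obtain a b where "p = {a, b}" "a \<noteq> b" using assms by (meson card_2_iff)
    then show "decomposable (blowup {p})" using decomposable_blowup_pair by simp
  qed auto
  then show ?thesis by simp
qed

text \<open>The basic matched pair of group triples: a relabelled \<open>K_{3,3,6}\<close>.\<close>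

lemma decomposable_blowup_star2:
  fixes a b c d :: nat
  assumes "distinct [a, b, c, d]"
  shows "decomposable (blowup (star {a, b} {c, d}))"
proof -
  \<comment> \<open>Injectivity is asked only on the labels 0 to 3, which are valid list
    positions.\<close>
  define h where "h i = [a, b, c, d] ! i" for i :: nat
  have "inj_on h (\<Union>{{0, 1, 2}, {0, 1, 3}})"
    using assms by (auto simp: inj_on_def h_def)
  from decomposable_blowup_image[OF decomposable_blowup_012_013 this]
  show ?thesis by (simp add: h_def star_def insert_commute)
qed

text \<open>Induction for matching arguments: elements are added two at a time.\<close>

lemma even_card_induct [consumes 2, case_names empty insert2]:
  assumes "finite M" "even (card M)" "P {}"
    and step: "\<And>x y M. \<lbrakk>finite M; even (card M); x \<notin> M; y \<notin> M; x \<noteq> y; P M\<rbrakk>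
      \<Longrightarrow> P (insert x (insert y M))"
  shows "P M"
  using assms(1,2)
proof (induction "card M" arbitrary: M rule: less_induct)
  case less
  show ?case
  proof (cases "M = {}")
    case False
    then have "card M \<ge> 2"
      using less.prems by (metis card_eq_0_iff dvd_imp_le less_eq_Suc_le not_gr_zero)
    then obtain Q where "Q \<subseteq> M" "card Q = 2" by (meson obtain_subset_with_card_n)
    then obtain x y where xy: "x \<in> M" "y \<in> M" "x \<noteq> y" by (auto simp: card_2_iff)
    define N where "N = M - {x, y}"
    have "card M = card N + 2" "finite N" "M = insert x (insert y N)" "x \<notin> N" "y \<notin> N"
      using xy less.prems \<open>card M \<ge> 2\<close> by (auto simp: N_def card_Diff_subset)
    then show ?thesis using less.hyps[of N] less.prems step xy(3) by auto
  qed (simp add: assms(3))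
qed

text \<open>Pair up the elements of \<open>W\<close>; each two of them give one matched pair over
  \<open>p\<close>.\<close>

lemma decomposable_blowup_star:
  fixes W :: "nat set"
  assumes "finite W" "even (card W)" "card p = 2" "p \<inter> W = {}"
  shows "decomposable (blowup (star p W))"
  using assms
proof (induction W rule: even_card_induct)
  case empty
  show ?case by (simp add: star_def decomposable_blowup_empty)
next
  case (insert2 x y M)
  obtain a b where ab: "p = {a, b}" "a \<noteq> b" using insert2.prems by (meson card_2_iff)
  have "star p (insert x (insert y M)) = star p {x, y} \<union> star p M"
    by (auto simp: star_def)
  moreover have "decomposable (blowup (star p {x, y}))"
    using decomposable_blowup_star2[of a b x y] ab insert2 by auto
  moreover have "star p {x, y} \<inter> star p M = {}"
    using insert2 by (auto simp: star_def)
  ultimately show ?case using decomposable_blowup_Un insert2 by auto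
qed

section \<open>Cones: the triples through one fixed group\<close>

lemma pairs_empty: "pairs {} = {}"
  by (auto simp: pairs_def)

lemma pairs_insert:
  assumes "x \<notin> M"
  shows "pairs (insert x M) = pairs M \<union> star {x} M"
proof (intro equalityI subsetI)
  fix p assume "p \<in> pairs (insert x M)"
  then show "p \<in> pairs M \<union> star {x} M"
    by (auto simp: pairs_def star_def card_2_iff insert_commute)
qed (use assms in \<open>auto simp: pairs_def star_def card_insert_if\<close>)

text \<open>The six edges of \<open>K_4\<close> split into three paths with two edges, centred at
  \<open>a\<close>, \<open>d\<close> and \<open>c\<close>. The two edges of a path share its centre,
  so after adding \<open>x\<close> they become triples sharing two groups.\<close>

lemma decomposable_blowup_cone_4:
  fixes x :: nat
  assumes "card Q = 4" "x \<notin> Q"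
  shows "decomposable (blowup (insert x ` pairs Q))"
proof -
  obtain a b c d where Q: "Q = {a, b, c, d}" "distinct [a, b, c, d]"
    using assms(1) by (auto simp: card_Suc_eq numeral_eq_Suc)
  have "pairs Q = {{a, b}, {a, c}, {a, d}, {b, d}, {b, c}, {c, d}}"
    using Q by (simp add: pairs_insert pairs_empty star_def insert_commute)
  then have eq: "insert x ` pairs Q = star {x, a} {b, c} \<union> (star {x, d} {a, b} \<union> star {x, c} {b, d})"
    by (auto simp: star_def insert_commute)
  \<comment> \<open>Membership of \<open>a\<close>, \<open>d\<close> and \<open>c\<close> separates
    the three stars cyclically.\<close>
  have "a \<in> S \<and> d \<notin> S" if "S \<in> star {x, a} {b, c}" for S
    using that Q assms(2) by (auto simp: star_def)
  moreover have "d \<in> S \<and> c \<notin> S" if "S \<in> star {x, d} {a, b}" for S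
    using that Q assms(2) by (auto simp: star_def)
  moreover have "c \<in> S \<and> a \<notin> S" if "S \<in> star {x, c} {b, d}" for S
    using that Q assms(2) by (auto simp: star_def)
  ultimately have "star {x, a} {b, c} \<inter> (star {x, d} {a, b} \<union> star {x, c} {b, d}) = {}"
    "star {x, d} {a, b} \<inter> star {x, c} {b, d} = {}" by blast+
  then show ?thesis
    unfolding eq using Q assms(2) by (intro decomposable_blowup_Un decomposable_blowup_star2) auto
qed

text \<open>Split off a 4-set \<open>Q\<close>. Pairs within \<open>Q\<close> are the previous case,
  pairs from \<open>w\<close> to \<open>Q\<close> form a star over \<open>{x, w}\<close> of even
  size 4, and the rest is inductive. The congruence says exactly that the number of pairs is
  even.\<close>

lemma decomposable_blowup_cone:
  fixes x :: nat
  assumes "finite M" "card M mod 4 \<in> {0, 1}" "x \<notin> M"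
  shows "decomposable (blowup (insert x ` pairs M))"
  using assms
proof (induction "card M" arbitrary: M rule: less_induct)
  case less
  show ?case
  proof (cases "card M < 4")
    case True
    \<comment> \<open>Sizes 2 and 3 are excluded by the congruence, so no pair is left.\<close>
    then have "card M \<le> 1" using less.prems by auto
    then have "p \<notin> pairs M" for p
      using card_mono[OF less.prems(1), of p] by (auto simp: pairs_def)
    then have "pairs M = {}" by blast
    then show ?thesis by (simp add: decomposable_blowup_empty)
  next
    case False
    then obtain Q where Q: "Q \<subseteq> M" "card Q = 4" by (meson not_le obtain_subset_with_card_n)
    define N where "N = M - Q"
    have finQ: "finite Q" using Q by (simp add: card_ge_0_finite)
    have N: "finite N" "card M = card N + 4" "M = N \<union> Q" "N \<inter> Q = {}"
      using less.prems(1) Q finQ False by (auto simp: N_def card_Diff_subset)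
    have "pairs M = pairs N \<union> (\<Union>w\<in>N. star {w} Q) \<union> pairs Q"
    proof (intro equalityI subsetI)
      fix p assume "p \<in> pairs M"
      then obtain u v where "p = {u, v}" "u \<noteq> v" "u \<in> M" "v \<in> M"
        by (auto simp: pairs_def card_2_iff)
      then show "p \<in> pairs N \<union> (\<Union>w\<in>N. star {w} Q) \<union> pairs Q"
        unfolding N(3) by (auto simp: pairs_def star_def insert_commute)
    next
      fix p assume "p \<in> pairs N \<union> (\<Union>w\<in>N. star {w} Q) \<union> pairs Q"
      then show "p \<in> pairs M"
        using N(4) unfolding N(3) by (auto simp: pairs_def star_def card_insert_if)
    qed
    then have eq: "insert x ` pairs M =
        insert x ` pairs N \<union> (\<Union>w\<in>N. star {x, w} Q) \<union> insert x ` pairs Q"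
      by (simp add: image_Un image_UN star_def image_image insert_commute)
    have "decomposable (blowup (insert x ` pairs N))"
      using less.hyps[of N] less.prems N by auto
    moreover have "decomposable (blowup (\<Union>w\<in>N. star {x, w} Q))"
    proof (rule decomposable_blowup_UN)
      fix w assume "w \<in> N"
      then show "decomposable (blowup (star {x, w} Q))"
        using Q finQ less.prems N by (intro decomposable_blowup_star) (auto simp: card_insert_if)
    next
      fix w w' assume "w \<in> N" "w' \<in> N" "w \<noteq> w'"
      \<comment> \<open>The trace on \<open>N\<close> identifies \<open>w\<close>; below, traces on
        \<open>Q\<close> and \<open>N\<close> likewise separate the three families.\<close>
      moreover have "S \<inter> N = {u}" if "S \<in> star {x, u} Q" "u \<in> N" for S u
        using that N less.prems(3) by (auto simp: star_def)
      ultimately show "star {x, w} Q \<inter> star {x, w'} Q = {}" by blast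
    qed
    moreover have "decomposable (blowup (insert x ` pairs Q))"
      using decomposable_blowup_cone_4 Q less.prems(3) by blast
    moreover have "insert x ` pairs N \<inter> (\<Union>w\<in>N. star {x, w} Q) = {}"
    proof -
      have "S \<inter> Q = {}" if "S \<in> insert x ` pairs N" for S
        using that N less.prems(3) by (auto simp: pairs_def)
      moreover have "S \<inter> Q \<noteq> {}" if "S \<in> (\<Union>w\<in>N. star {x, w} Q)" for S
        using that by (auto simp: star_def)
      ultimately show ?thesis by blast
    qed
    moreover have "(insert x ` pairs N \<union> (\<Union>w\<in>N. star {x, w} Q)) \<inter> insert x ` pairs Q = {}"
    proof -
      have "S \<inter> N \<noteq> {}" if "S \<in> insert x ` pairs N \<union> (\<Union>w\<in>N. star {x, w} Q)" for S
        using that by (auto simp: star_def pairs_def card_2_iff)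
      moreover have "S \<inter> N = {}" if "S \<in> insert x ` pairs Q" for S
        using that N less.prems(3) by (auto simp: pairs_def)
      ultimately show ?thesis by blast
    qed
    ultimately show ?thesis unfolding eq by (intro decomposable_blowup_Un)
  qed
qed

section \<open>Triples of groups within one half\<close>

lemma triples_insert:
  assumes "x \<notin> M"
  shows "triples (insert x M) = triples M \<union> insert x ` pairs M"
proof (intro equalityI subsetI)
  fix e assume e: "e \<in> triples (insert x M)"
  show "e \<in> triples M \<union> insert x ` pairs M"
  proof (cases "x \<in> e")
    case True
    then have "e = insert x (e - {x})" "e - {x} \<in> pairs M"
      using e by (auto simp: triples_def pairs_def)
    then show ?thesis by blast
  qed (use e in \<open>auto simp: triples_def\<close>)
next
  fix e assume "e \<in> triples M \<union> insert x ` pairs M"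
  moreover have "card (insert x p) = 3" if "p \<in> pairs M" for p
  proof -
    have "finite p" using that by (simp add: pairs_def card_ge_0_finite)
    then show ?thesis using that assms by (auto simp: pairs_def card_insert_if)
  qed
  ultimately show "e \<in> triples (insert x M)" by (auto simp: triples_def pairs_def)
qed

text \<open>After adding \<open>x\<close> and \<open>y\<close>, a new triple with just one of them
  is matched with the one obtained by exchanging \<open>x\<close> and \<open>y\<close>; those with
  both form a star over \<open>{x, y}\<close> of even size.\<close>

lemma decomposable_blowup_triples_even:
  fixes M :: "nat set"
  assumes "finite M" "even (card M)"
  shows "decomposable (blowup (triples M))"
  using assms
proof (induction M rule: even_card_induct)
  case empty
  have "triples {} = ({} :: nat set set)" by (auto simp: triples_def)
  then show ?case by (simp add: decomposable_blowup_empty)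
next
  case (insert2 x y M)
  have 1: "insert x ` star {y} M = star {x, y} M"
    by (auto simp: star_def insert_commute)
  have 2: "insert y ` pairs M \<union> insert x ` pairs M = (\<Union>p\<in>pairs M. star p {x, y})"
    by (auto simp: star_def)
  have eq: "triples (insert x (insert y M)) =
      triples M \<union> (\<Union>p\<in>pairs M. star p {x, y}) \<union> star {x, y} M"
    using insert2 by (simp add: triples_insert pairs_insert image_Un Un_assoc 1 2[symmetric])
  have "decomposable (blowup (\<Union>p\<in>pairs M. star p {x, y}))"
  proof (rule decomposable_blowup_UN)
    fix p assume "p \<in> pairs M"
    then show "decomposable (blowup (star p {x, y}))"
      using insert2 by (intro decomposable_blowup_star) (auto simp: pairs_def)
  next
    fix p q assume pq: "p \<in> pairs M" "q \<in> pairs M" "p \<noteq> q"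
    have "S \<inter> M = r" if "S \<in> star r {x, y}" "r \<in> pairs M" for S r
      using that insert2 by (auto simp: star_def pairs_def)
    then show "star p {x, y} \<inter> star q {x, y} = {}" using pq by blast
  qed
  moreover have "decomposable (blowup (star {x, y} M))"
    using insert2 by (intro decomposable_blowup_star) auto
  moreover have "triples M \<inter> (\<Union>p\<in>pairs M. star p {x, y}) = {}"
    using insert2 by (auto simp: star_def triples_def)
  moreover have "(triples M \<union> (\<Union>p\<in>pairs M. star p {x, y})) \<inter> star {x, y} M = {}"
  proof -
    have "\<not> {x, y} \<subseteq> S" if "S \<in> triples M \<union> (\<Union>p\<in>pairs M. star p {x, y})" for S
      using that insert2 by (auto simp: star_def triples_def pairs_def)
    moreover have "{x, y} \<subseteq> S" if "S \<in> star {x, y} M" for S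
      using that by (auto simp: star_def)
    ultimately show ?thesis by blast
  qed
  ultimately show ?case unfolding eq using insert2 by (intro decomposable_blowup_Un)
qed

text \<open>In the odd case the size is 1 mod 4. Removing one element \<open>x\<close> leaves a set
  \<open>N\<close> of size 0 mod 4, where both the triples of \<open>N\<close> and the cone from
  \<open>x\<close> can be matched. For size 3 mod 4 the number of triples is odd.\<close>

lemma decomposable_blowup_triples:
  fixes M :: "nat set"
  assumes "finite M" "card M mod 4 \<noteq> 3"
  shows "decomposable (blowup (triples M))"
proof (cases "even (card M)")
  case False
  then have "M \<noteq> {}" by auto
  then obtain x N where N: "M = insert x N" "x \<notin> N" by (meson mk_disjoint_insert all_not_in_conv)
  then have fin: "finite N" using assms(1) by simp
  then have card: "card M = Suc (card N)" using N by simp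
  then have mod: "card N mod 4 = 0" using False assms(2) by presburger
  have "decomposable (blowup (triples N))"
    using fin False card by (intro decomposable_blowup_triples_even) auto
  moreover have "decomposable (blowup (insert x ` pairs N))"
    using fin N mod by (intro decomposable_blowup_cone) auto
  moreover have "triples N \<inter> insert x ` pairs N = {}"
    using N by (auto simp: triples_def)
  ultimately show ?thesis
    using N by (simp add: triples_insert decomposable_blowup_Un)
qed (use assms decomposable_blowup_triples_even in blast)

section \<open>Mixed triples of groups\<close>

lemma decomposable_blowup_half_mixed:
  fixes A B :: "nat set"
  assumes fin: "finite A" "finite B" and disj: "A \<inter> B = {}"
    and card: "even (card B) \<or> card A mod 4 \<in> {0, 1}"
  shows "decomposable (blowup (\<Union>p\<in>pairs A. star p B))"
proof -
  show ?thesis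
    using card
  proof
    \<comment> \<open>Fix the pair in \<open>A\<close> and match along \<open>B\<close>.\<close>
    assume even: "even (card B)"
    show ?thesis
    proof (rule decomposable_blowup_UN)
      fix p assume "p \<in> pairs A"
      then show "decomposable (blowup (star p B))"
        using fin even disj by (intro decomposable_blowup_star) (auto simp: pairs_def)
    next
      fix p q assume "p \<in> pairs A" "q \<in> pairs A" "p \<noteq> q"
      moreover have "S \<inter> A = r" if "S \<in> star r B" "r \<in> pairs A" for S r
        using that disj by (auto simp: star_def pairs_def)
      ultimately show "star p B \<inter> star q B = {}" by blast
    qed
  next
    \<comment> \<open>Fix the element of \<open>B\<close> and match the pairs of \<open>A\<close> as
      in a cone.\<close>
    assume mod: "card A mod 4 \<in> {0, 1}"
    have "decomposable (blowup (\<Union>b\<in>B. insert b ` pairs A))"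
    proof (rule decomposable_blowup_UN)
      fix b assume "b \<in> B"
      then show "decomposable (blowup (insert b ` pairs A))"
        using fin mod disj by (intro decomposable_blowup_cone) auto
    next
      fix b c assume "b \<in> B" "c \<in> B" "b \<noteq> c"
      moreover have "S \<inter> B = {d}" if "S \<in> insert d ` pairs A" "d \<in> B" for S d
        using that disj by (auto simp: pairs_def)
      ultimately show "insert b ` pairs A \<inter> insert c ` pairs A = {}" by blast
    qed
    moreover have "(\<Union>b\<in>B. insert b ` pairs A) = (\<Union>p\<in>pairs A. star p B)"
      by (auto simp: star_def)
    ultimately show ?thesis by simp
  qed
qed

lemma decomposable_blowup_mixed_triples:
  fixes A B :: "nat set"
  assumes fin: "finite A" "finite B" and disj: "A \<inter> B = {}"
    and card: "card A = card B" "card B mod 4 \<noteq> 3"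
  shows "decomposable (blowup (mixed_triples A B))"
proof -
  \<comment> \<open>Both halves, and then all mixed triples, are described by the sizes of their
    traces, so that the splitting becomes purely propositional.\<close>
  have half: "S \<in> (\<Union>p\<in>pairs X. star p Y) \<longleftrightarrow>
      S \<subseteq> X \<union> Y \<and> card (S \<inter> X) = 2 \<and> card (S \<inter> Y) = 1"
    if XY: "X \<inter> Y = {}" for S X Y :: "nat set"
  proof
    assume "S \<in> (\<Union>p\<in>pairs X. star p Y)"
    then obtain p y where p: "p \<in> pairs X" "y \<in> Y" "S = insert y p"
      by (auto simp: star_def)
    then have SXY: "S \<inter> X = p" "S \<inter> Y = {y}" using XY by (auto simp: pairs_def)
    show "S \<subseteq> X \<union> Y \<and> card (S \<inter> X) = 2 \<and> card (S \<inter> Y) = 1"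
      unfolding SXY using p by (auto simp: pairs_def)
  next
    assume S: "S \<subseteq> X \<union> Y \<and> card (S \<inter> X) = 2 \<and> card (S \<inter> Y) = 1"
    then obtain y where "S \<inter> Y = {y}" by (auto simp: card_1_singleton_iff)
    then have "S = insert y (S \<inter> X)" "y \<in> Y" using S by auto
    moreover have "S \<inter> X \<in> pairs X" using S by (simp add: pairs_def)
    ultimately show "S \<in> (\<Union>p\<in>pairs X. star p Y)" unfolding star_def by blast
  qed
  have mixed: "S \<in> mixed_triples A B \<longleftrightarrow> S \<subseteq> A \<union> B \<and>
      (card (S \<inter> A) = 2 \<and> card (S \<inter> B) = 1 \<or> card (S \<inter> A) = 1 \<and> card (S \<inter> B) = 2)" for S
  proof (cases "S \<subseteq> A \<union> B")
    case True
    then have finS: "finite S" using fin by (meson finite_UnI finite_subset)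
    have "card S = card (S \<inter> A) + card (S \<inter> B)"
      using card_Un_disjoint[of "S \<inter> A" "S \<inter> B"] finS disj True
      by (metis Int_Un_distrib Int_absorb2 finite_Int inf_assoc inf_bot_right inf_left_commute)
    moreover have "S \<inter> A \<noteq> {} \<longleftrightarrow> card (S \<inter> A) \<ge> 1" "S \<inter> B \<noteq> {} \<longleftrightarrow> card (S \<inter> B) \<ge> 1"
      using finS by (auto simp: Suc_le_eq card_gt_0_iff)
    ultimately show ?thesis using True by (auto simp: mixed_triples_def triples_def)
  qed (auto simp: mixed_triples_def triples_def)
  have BA: "B \<inter> A = {}" using disj by blast
  have "mixed_triples A B = (\<Union>p\<in>pairs A. star p B) \<union> (\<Union>p\<in>pairs B. star p A)"
    unfolding set_eq_iff Un_iff[of _ "\<Union> _"] mixed half[OF disj] half[OF BA]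
    by (simp only: Un_commute[of B A]) blast
  moreover have "(\<Union>p\<in>pairs A. star p B) \<inter> (\<Union>p\<in>pairs B. star p A) = {}"
    unfolding disjoint_iff half[OF disj] half[OF BA] by simp
  \<comment> \<open>An odd common size is 1 mod 4, which is the cone case for either half.\<close>
  moreover have "even (card B) \<or> card B mod 4 \<in> {0, 1}"
    using card(2) by (simp; presburger)
  ultimately show ?thesis
    using decomposable_blowup_half_mixed[of A B] decomposable_blowup_half_mixed[of B A] assms
    by (simp add: decomposable_blowup_Un Int_commute)
qed

section \<open>From sets of groups to sets of points\<close>

definition points :: "nat set \<Rightarrow> nat set" where
  "points A = {x. x div 3 \<in> A}"

definition groups :: "nat set \<Rightarrow> nat set set" where
  "groups A = (\<lambda>i. {x. x div 3 = i}) ` A"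

lemma group_eq: "{x. x div 3 = i} = {3 * i, 3 * i + 1, 3 * i + (2::nat)}"
  by auto

lemma one_factor_groups: "one_factor (points A) (groups A)"
  by (auto simp: one_factor_def triples_def groups_def points_def)
    (auto simp: group_eq card_insert_if)

text \<open>A 3-set inside one group fills it, since groups have three points.\<close>

lemma mem_groups_iff:
  assumes "card e = 3" shows "e \<in> groups A \<longleftrightarrow> (\<exists>i\<in>A. (\<lambda>x. x div 3) ` e = {i})"
proof
  assume "e \<in> groups A"
  then obtain i where i: "i \<in> A" "e = {x. x div 3 = i}" by (auto simp: groups_def)
  then have "3 * i \<in> e" by simp
  then have "{i} \<subseteq> (\<lambda>x. x div 3) ` e" using rev_image_eqI[of "3 * i" e i "\<lambda>x. x div 3"] by simp
  then have "(\<lambda>x. x div 3) ` e = {i}" using i(2) by blast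
  then show "\<exists>i\<in>A. (\<lambda>x. x div 3) ` e = {i}" using i(1) by blast
next
  assume "\<exists>i\<in>A. (\<lambda>x. x div 3) ` e = {i}"
  then obtain i where i: "i \<in> A" "(\<lambda>x. x div 3) ` e = {i}" by blast
  have "e \<subseteq> {x. x div 3 = i}" using i(2) by blast
  moreover have "finite {x. x div 3 = i}" "card {x. x div 3 = i} = 3"
    by (auto simp: group_eq card_insert_if)
  ultimately have "e = {x. x div 3 = i}" using assms by (metis card_subset_eq)
  then show "e \<in> groups A" using i(1) by (auto simp: groups_def)
qed

lemma card_div_image_cases:
  assumes "card (e :: nat set) = 3"
  obtains i where "(\<lambda>x. x div 3) ` e = {i}" | "card ((\<lambda>x. x div 3) ` e) = 2"
    | "card ((\<lambda>x. x div 3) ` e) = 3"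
proof -
  have fin: "finite e" using assms by (simp add: card_ge_0_finite)
  have "card ((\<lambda>x. x div 3) ` e) \<le> 3" using card_image_le[OF fin] assms by metis
  moreover have "card ((\<lambda>x. x div 3) ` e) \<noteq> 0" using fin assms by auto
  ultimately consider "card ((\<lambda>x. x div 3) ` e) = 1" | "card ((\<lambda>x. x div 3) ` e) = 2"
    | "card ((\<lambda>x. x div 3) ` e) = 3" by linarith
  then show ?thesis using that by cases (auto simp: card_1_singleton_iff)
qed

text \<open>Deleting the 1-factor removes exactly the triples that meet a single group; the others
  meet two or three.\<close>

lemma triples_points: "triples (points A) - groups A = blowup (pairs A \<union> triples A)"
proof (rule set_eqI)
  fix e :: "nat set"
  show "e \<in> triples (points A) - groups A \<longleftrightarrow> e \<in> blowup (pairs A \<union> triples A)"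
  proof (cases "card e = 3")
    case True
    have "e \<subseteq> points A \<longleftrightarrow> (\<lambda>x. x div 3) ` e \<subseteq> A" by (auto simp: points_def)
    with True show ?thesis
      by (cases rule: card_div_image_cases)
        (auto simp: mem_groups_iff triples_def blowup_def pairs_def)
  qed (auto simp: triples_def blowup_def)
qed

text \<open>A mixed triple never lies in a single group, because \<open>A\<close> and
  \<open>B\<close> are disjoint; hence nothing is deleted here.\<close>

lemma mixed_triples_points:
  assumes "A \<inter> B = {}"
  shows "mixed_triples (points A) (points B) =
    blowup ({p \<in> pairs (A \<union> B). p \<inter> A \<noteq> {} \<and> p \<inter> B \<noteq> {}} \<union> mixed_triples A B)"
proof (rule set_eqI)
  fix e :: "nat set"
  let ?g = "\<lambda>x::nat. x div 3"
  show "e \<in> mixed_triples (points A) (points B) \<longleftrightarrow>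
    e \<in> blowup ({p \<in> pairs (A \<union> B). p \<inter> A \<noteq> {} \<and> p \<inter> B \<noteq> {}} \<union> mixed_triples A B)"
  proof (cases "card e = 3")
    case True
    have 1: "e \<subseteq> points A \<union> points B \<longleftrightarrow> ?g ` e \<subseteq> A \<union> B"
      "e \<inter> points X \<noteq> {} \<longleftrightarrow> ?g ` e \<inter> X \<noteq> {}" for X by (auto simp: points_def)
    have 2: "e \<in> mixed_triples (points A) (points B) \<longleftrightarrow>
        ?g ` e \<subseteq> A \<union> B \<and> ?g ` e \<inter> A \<noteq> {} \<and> ?g ` e \<inter> B \<noteq> {}"
      using True 1 by (simp add: mixed_triples_def triples_def)
    have 3: "e \<in> blowup ({p \<in> pairs (A \<union> B). p \<inter> A \<noteq> {} \<and> p \<inter> B \<noteq> {}} \<union> mixed_triples A B)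
      \<longleftrightarrow> (card (?g ` e) = 2 \<or> card (?g ` e) = 3) \<and>
        ?g ` e \<subseteq> A \<union> B \<and> ?g ` e \<inter> A \<noteq> {} \<and> ?g ` e \<inter> B \<noteq> {}"
      using True unfolding blowup_def pairs_def mixed_triples_def triples_def by blast
    from True show ?thesis
      unfolding 2 3 by (cases rule: card_div_image_cases) (use assms in auto)
  qed (auto simp: mixed_triples_def triples_def blowup_def)
qed

section \<open>The three parts of the split and their assembly\<close>

lemma decomposable_triples_points:
  assumes "finite A" "card A mod 4 \<noteq> 3"
  shows "decomposable (triples (points A) - groups A)"
  unfolding triples_points
proof (rule decomposable_blowup_Un)
  show "decomposable (blowup (pairs A))"
    by (rule decomposable_blowup_pairs) (simp add: pairs_def)
  show "decomposable (blowup (triples A))"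
    using assms by (rule decomposable_blowup_triples)
qed (auto simp: pairs_def triples_def)

lemma decomposable_mixed_triples_points:
  assumes "finite A" "finite B" "A \<inter> B = {}" "card A = card B" "card B mod 4 \<noteq> 3"
  shows "decomposable (mixed_triples (points A) (points B))"
  unfolding mixed_triples_points[OF assms(3)]
proof (rule decomposable_blowup_Un)
  show "decomposable (blowup {p \<in> pairs (A \<union> B). p \<inter> A \<noteq> {} \<and> p \<inter> B \<noteq> {}})"
    by (rule decomposable_blowup_pairs) (simp add: pairs_def)
  show "decomposable (blowup (mixed_triples A B))"
    using assms by (rule decomposable_blowup_mixed_triples)
qed (auto simp: pairs_def triples_def mixed_triples_def)

theorem theorem17:
  fixes v :: nat
  assumes "v mod 24 \<in> {0, 6, 12}" and "v \<ge> 12"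
  shows "\<exists>I. one_factor {..<v} I \<and> two_split_decomposition 6 {..<v} I"
proof -
  \<comment> \<open>\<open>m\<close> is the number of groups in each half; the residues 0, 6, 12 of
    \<open>v\<close> mod 24 are the residues 0, 1, 2 of \<open>m\<close> mod 4.\<close>
  obtain m where v: "v = 6 * m" and m: "m mod 4 \<noteq> 3"
  proof
    have "v mod 24 = 0 \<or> v mod 24 = 6 \<or> v mod 24 = 12" using assms(1) by simp
    then show "v = 6 * (v div 6)" "(v div 6) mod 4 \<noteq> 3" by presburger+
  qed
  \<comment> \<open>Group indices of the two halves, whose points are the intervals below and from
    \<open>3 * m\<close>.\<close>
  define A B where "A = {..<m}" and "B = {m..<2 * m}"
  have AB: "finite A" "finite B" "A \<inter> B = {}" "card A = m" "card B = m"
    by (auto simp: A_def B_def)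
  have pA: "points A = {..<3 * m}" and pB: "points B = {3 * m..<6 * m}"
    by (auto simp: A_def B_def points_def)
  have "points (A \<union> B) = {..<v}" by (auto simp: A_def B_def points_def v)
  then have factor: "one_factor {..<v} (groups (A \<union> B))" using one_factor_groups by metis
  obtain C1 C2 C3 where
    "cycle_decomposition 6 (triples (points A) - groups A) C1"
    "cycle_decomposition 6 (triples (points B) - groups B) C2"
    "cycle_decomposition 6 (mixed_triples (points A) (points B)) C3"
    using decomposable_triples_points[of A] decomposable_triples_points[of B]
      decomposable_mixed_triples_points[of A B] AB m unfolding decomposable_def by auto
  moreover have "points A \<union> points B = {..<v}" "points A \<inter> points B = {}"
    "card (points A) = card {..<v} div 2" "card (points B) = card {..<v} div 2"
    by (auto simp: pA pB v)
  moreover have "groups (A \<union> B) = groups A \<union> groups B" by (simp add: groups_def image_Un)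
  ultimately have "two_split_decomposition 6 {..<v} (groups (A \<union> B))"
    unfolding two_split_decomposition_def using one_factor_groups[of A] one_factor_groups[of B]
    by (intro exI conjI)
  with factor show ?thesis by blast
qed

end
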